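(* Let $\beta_1,\beta_2>1$ with $\beta_1\neq\beta_2$. (i) If $w\in\{p,m\}^*$ is a finite word and $(x,y)=\pi(wm^\infty)$ or $(x,y)=\pi(wp^\infty)$ belongs to the set of uniqueness $\mathcal U_{\beta_1,\beta_2}$, then $(x,y)\in\partial A_{\beta_1,\beta_2}$. (ii) $\pi(U')\subset\partial A_{\beta_1,\beta_2}$, where $U'\subset\{p,m\}^{\mathbb N}$ is the set defined in the context.
   Context: Write $p=+1$, $m=-1$; $\{p,m\}^*$ is the set of finite words over $\{p,m\}$. For $\beta_1,\beta_2>1$ define $\pi:\{p,m\}^{\mathbb N}\to\mathbb R^2$ by $\pi(w)=\left(\sum_{i\ge1}w_i\beta_1^{-i},\sum_{i\ge1}w_i\beta_2^{-i}\right)$, and let $A_{\beta_1,\beta_2}=\pi(\{p,m\}^{\mathbb N})$ (equivalently, the attractor of the maps $T_{\pm1}(x,y)=\left(\frac{x\pm1}{\beta_1},\frac{y\pm1}{\beta_2}\right)$); $\partial$ denotes topological boundary in $\mathbb R^2$. The set of uniqueness $\mathcal U_{\beta_1,\beta_2}$ is the set of points $\pi(w)$ such that $\pi(w')\neq\pi(w)$ for every $w'\in\{p,m\}^{\mathbb N}$, $w'\ne w$. For a finite word $v$, $[v]\subset\{p,m\}^{\mathbb N}$ denotes the cylinder of infinite words with prefix $v$, and $\mathrm{dist}$ is Euclidean distance between sets. For $k\ge1$ put $L_k=\min\{j\ge1:\mathrm{dist}(\pi([p^km^j]),\pi([m]))>0\}$ and $L=\max_{k\ge1}L_k$ (this is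 well defined and finite). Define \[U'=\{p^{k_0}m^{k_1}p^{k_2}\cdots: k_0\ge1,\ k_i\ge L\ (i\ge1)\}\cup\{m^{k_0}p^{k_1}m^{k_2}\cdots: k_0\ge1,\ k_i\ge L\ (i\ge1)\}.\] *)

theory Defs
  imports "HOL-Analysis.Analysis" "HOL-Library.Stream"
begin

text \<open>The letters \<open>p\<close> and \<open>m\<close> are the real numbers \<open>1\<close> and \<open>-1\<close>. Finite words are elements of
  \<open>lists letters\<close>, infinite words are elements of \<open>streams letters\<close>; streams are indexed from \<open>0\<close>,
  so the letter \<open>w\<^sub>i\<close> (\<open>i \<ge> 1\<close>) is \<open>w !! (i - 1)\<close>.\<close>

definition letters :: "real set" where
  "letters = {1, -1}"

definition proj :: "real \<Rightarrow> real \<Rightarrow> real stream \<Rightarrow> real \<times> real" where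
  "proj \<beta>1 \<beta>2 w = ((\<Sum>i. w !! i / \<beta>1 ^ Suc i), (\<Sum>i. w !! i / \<beta>2 ^ Suc i))"

definition attractor :: "real \<Rightarrow> real \<Rightarrow> (real \<times> real) set" where
  "attractor \<beta>1 \<beta>2 = proj \<beta>1 \<beta>2 ` streams letters"

definition uniqueness_set :: "real \<Rightarrow> real \<Rightarrow> (real \<times> real) set" where
  "uniqueness_set \<beta>1 \<beta>2 = {proj \<beta>1 \<beta>2 w | w. w \<in> streams letters \<and>
     (\<forall>w' \<in> streams letters. w' \<noteq> w \<longrightarrow> proj \<beta>1 \<beta>2 w' \<noteq> proj \<beta>1 \<beta>2 w)}"

definition cylinder :: "real list \<Rightarrow> real stream set" where
  "cylinder v = {w \<in> streams letters. stake (length v) w = v}"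

text \<open>The metric on \<^typ>\<open>real \<times> real\<close> is the Euclidean one. For all \<open>\<beta>1, \<beta>2 > 1\<close> with \<open>\<beta>1 \<noteq> \<beta>2\<close>
  the minimum in \<open>Lmin\<close> exists for every \<open>k \<ge> 1\<close>, and \<open>Lmin \<beta>1 \<beta>2 k = 1\<close> for all large \<open>k\<close>, so that
  the maximum in \<open>Lmax\<close> is taken over a finite set of values.\<close>

definition Lmin :: "real \<Rightarrow> real \<Rightarrow> nat \<Rightarrow> nat" where
  "Lmin \<beta>1 \<beta>2 k = (LEAST j. 1 \<le> j \<and>
     0 < setdist (proj \<beta>1 \<beta>2 ` cylinder (replicate k 1 @ replicate j (-1)))
                 (proj \<beta>1 \<beta>2 ` cylinder [-1]))"

definition Lmax :: "real \<Rightarrow> real \<Rightarrow> nat" where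
  "Lmax \<beta>1 \<beta>2 = Max (Lmin \<beta>1 \<beta>2 ` {1..})"

text \<open>\<open>blocks a k\<close> is the infinite concatenation of the blocks \<open>a\<^sup>k\<^sup>0 (-a)\<^sup>k\<^sup>1 a\<^sup>k\<^sup>2 \<dots>\<close>. It is only
  meaningful if every \<open>k i\<close> is positive, since \<^const>\<open>flat\<close> is unspecified on empty lists; in
  \<open>U'\<close> below this holds because \<open>Lmax \<beta>1 \<beta>2 \<ge> 1\<close>.\<close>

definition blocks :: "real \<Rightarrow> (nat \<Rightarrow> nat) \<Rightarrow> real stream" where
  "blocks a k = flat (smap (\<lambda>i. replicate (k i) (if even i then a else - a)) nats)"

definition U' :: "real \<Rightarrow> real \<Rightarrow> real stream set" where
  "U' \<beta>1 \<beta>2 =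
     {blocks 1 k | k. 1 \<le> k 0 \<and> (\<forall>i\<ge>1. Lmax \<beta>1 \<beta>2 \<le> k i)} \<union>
     {blocks (-1) k | k. 1 \<le> k 0 \<and> (\<forall>i\<ge>1. Lmax \<beta>1 \<beta>2 \<le> k i)}"

end

theory Submission imports Defs begin

text \<open>Part (i) combines compactness with an extremality property. If \<open>\<pi>(w c\<^sup>\<infinity>)\<close> has only one
  expansion, then it avoids the compact image of the words that do not begin with \<open>w\<close>, so that near
  this point the attractor coincides with the image of the cylinder \<open>[w]\<close>. Among the words in \<open>[w]\<close>,
  the word \<open>w c\<^sup>\<infinity>\<close> has the extreme first coordinate, and an extreme point is not interior.

  For part (ii), call a word spaced if each of its runs, except perhaps the initial one, has length at
  least \<open>L\<close>. Spaced words are words of unique expansion: at the first disagreement with another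
  expansion, the two tails are, up to a change of sign, in \<open>[p\<^sup>k m\<^sup>L]\<close> and \<open>[m]\<close>, and these
  have disjoint images by the choice of \<open>L\<close> (a tail \<open>p\<^sup>\<infinity>\<close> is excluded by its first coordinate).
  Replacing a spaced word after some position by its constant continuation preserves spacedness, so
  part (i) puts the image of the new word on the boundary; since the boundary is closed, the limit is
  on the boundary as well.

  That \<open>L\<close> is a true maximum of finitely many true minima is where \<open>\<beta>\<^sub>1 \<noteq> \<beta>\<^sub>2\<close> enters. If
  \<open>\<pi>(p\<^sup>k m\<^sup>\<infinity>) = \<pi>(m w')\<close>, then the difference of the two words gives a power series whose
  coefficients change sign at most once and which vanishes at \<open>1/\<beta>\<^sub>1\<close> and at \<open>1/\<beta>\<^sub>2\<close>; by the
  argument of Descartes' rule of signs there is at most one positive zero. Hence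
  \<open>\<pi>(p\<^sup>k m\<^sup>\<infinity>)\<close> is at positive distance from \<open>\<pi>([m])\<close>, and so is the image of a small enough
  cylinder around \<open>p\<^sup>k m\<^sup>\<infinity>\<close>. The point \<open>\<pi>(p\<^sup>\<infinity>)\<close> is not in \<open>\<pi>([m])\<close> either, so that
  \<open>\<pi>([p\<^sup>k])\<close> is at positive distance from \<open>\<pi>([m])\<close> for all large \<open>k\<close>, and then \<open>L\<^sub>k = 1\<close>.\<close>

section \<open>One coordinate of the projection\<close>

definition val :: "real \<Rightarrow> real stream \<Rightarrow> real" where
  "val \<beta> w = (\<Sum>i. w !! i / \<beta> ^ Suc i)"

lemma proj_eq_val: "proj \<beta>1 \<beta>2 w = (val \<beta>1 w, val \<beta>2 w)"
  by (simp add: proj_def val_def)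

lemma snth_letters:
  assumes "w \<in> streams letters"
  shows "w !! i = 1 \<or> w !! i = -1"
  using assms by (auto simp: streams_iff_snth letters_def)

lemma summable_inverse_powers:
  fixes \<beta> :: real
  assumes "1 < \<beta>"
  shows "summable (\<lambda>i. 1 / \<beta> ^ Suc i)"
proof -
  have "summable (\<lambda>i. (1 / \<beta>) ^ Suc i)"
    using assms by (subst summable_Suc_iff, intro summable_geometric) auto
  then show ?thesis by (simp add: power_one_over)
qed

lemma summable_val:
  assumes "1 < \<beta>" "w \<in> streams letters"
  shows "summable (\<lambda>i. w !! i / \<beta> ^ Suc i)"
proof (rule summable_comparison_test'[OF summable_inverse_powers[OF assms(1)]])
  fix n
  show "norm (w !! n / \<beta> ^ Suc n) \<le> 1 / \<beta> ^ Suc n"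
    using snth_letters[OF assms(2), of n] assms(1) by (auto simp: abs_mult)
qed

lemma val_mono:
  assumes "1 < \<beta>" "v \<in> streams letters" "w \<in> streams letters" "\<And>i. v !! i \<le> w !! i"
  shows "val \<beta> v \<le> val \<beta> w"
  unfolding val_def using assms
  by (intro suminf_le summable_val divide_right_mono) auto

lemma val_strict_mono:
  assumes "1 < \<beta>" "v \<in> streams letters" "w \<in> streams letters" "\<And>i. v !! i \<le> w !! i"
    and "v !! j < w !! j"
  shows "val \<beta> v < val \<beta> w"
proof -
  have "0 < (\<Sum>i. w !! i / \<beta> ^ Suc i - v !! i / \<beta> ^ Suc i)"
  proof (rule suminf_pos2)
    show "summable (\<lambda>i. w !! i / \<beta> ^ Suc i - v !! i / \<beta> ^ Suc i)"
      using assms by (intro summable_diff summable_val)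
    show "0 \<le> w !! i / \<beta> ^ Suc i - v !! i / \<beta> ^ Suc i" for i
      using assms(1) assms(4)[of i] by (simp add: divide_right_mono)
    show "0 < w !! j / \<beta> ^ Suc j - v !! j / \<beta> ^ Suc j"
      using assms(1,5) by (simp add: divide_strict_right_mono)
  qed
  also have "\<dots> = val \<beta> w - val \<beta> v"
    unfolding val_def using assms by (intro suminf_diff[symmetric] summable_val)
  finally show ?thesis by simp
qed

lemma val_uminus:
  assumes "1 < \<beta>" "w \<in> streams letters"
  shows "val \<beta> (smap uminus w) = - val \<beta> w"
  using suminf_minus[OF summable_val[OF assms]] by (simp add: val_def)

lemma val_stl:
  assumes "1 < \<beta>" "w \<in> streams letters"
  shows "val \<beta> w = (shd w + val \<beta> (stl w)) / \<beta>"
proof -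
  have t: "stl w \<in> streams letters" using assms(2) by (rule streams_stl)
  have "(\<Sum>i. w !! Suc i / \<beta> ^ Suc (Suc i)) = val \<beta> w - shd w / \<beta>"
    using suminf_split_head[OF summable_val[OF assms]] by (simp add: val_def)
  moreover have "(\<Sum>i. w !! Suc i / \<beta> ^ Suc (Suc i)) = val \<beta> (stl w) / \<beta>"
    using suminf_divide[OF summable_val[OF assms(1) t], of \<beta>]
    by (simp add: val_def mult.commute)
  ultimately show ?thesis by (simp add: add_divide_distrib)
qed

lemma val_diff_common_prefix:
  assumes "1 < \<beta>" "v \<in> streams letters" "w \<in> streams letters" "stake n v = stake n w"
  shows "val \<beta> v - val \<beta> w = (val \<beta> (sdrop n v) - val \<beta> (sdrop n w)) / \<beta> ^ n"
  using assms(2-4)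
proof (induction n arbitrary: v w)
  case (Suc n)
  have "val \<beta> v - val \<beta> w = (val \<beta> (stl v) - val \<beta> (stl w)) / \<beta>"
    using Suc.prems val_stl[OF assms(1)] by (simp add: diff_divide_distrib add_divide_distrib)
  also have "val \<beta> (stl v) - val \<beta> (stl w)
      = (val \<beta> (sdrop (Suc n) v) - val \<beta> (sdrop (Suc n) w)) / \<beta> ^ n"
    using Suc.IH[of "stl v" "stl w"] Suc.prems by (simp add: streams_stl)
  finally show ?case by (simp add: mult.commute)
qed simp

lemma val_bounds:
  assumes "1 < \<beta>" "w \<in> streams letters"
  shows "val \<beta> w \<le> val \<beta> (sconst 1)" "val \<beta> (sconst (-1)) \<le> val \<beta> w"
proof -
  have "w !! i \<le> 1" "-1 \<le> w !! i" for i using snth_letters[OF assms(2), of i] by auto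
  then show "val \<beta> w \<le> val \<beta> (sconst 1)" "val \<beta> (sconst (-1)) \<le> val \<beta> w"
    by (auto intro!: val_mono assms sconst_streams simp: letters_def)
qed

lemma sdrop_streams: "w \<in> streams A \<Longrightarrow> sdrop n w \<in> streams A"
  by (simp add: streams_iff_snth sdrop_snth)

lemma val_diff_le:
  assumes "1 < \<beta>" "v \<in> streams letters" "w \<in> streams letters" "stake n v = stake n w"
  shows "\<bar>val \<beta> v - val \<beta> w\<bar> \<le> (val \<beta> (sconst 1) - val \<beta> (sconst (-1))) / \<beta> ^ n"
proof -
  have "\<bar>val \<beta> (sdrop n v) - val \<beta> (sdrop n w)\<bar> \<le> val \<beta> (sconst 1) - val \<beta> (sconst (-1))"
    using val_bounds[OF assms(1) sdrop_streams[OF assms(2), of n]]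
      val_bounds[OF assms(1) sdrop_streams[OF assms(3), of n]] by linarith
  then show ?thesis
    unfolding val_diff_common_prefix[OF assms] using assms(1)
    by (simp add: divide_right_mono)
qed

section \<open>Continuity and compactness\<close>

lemma proj_close_if_common_prefix:
  assumes "1 < \<beta>1" "1 < \<beta>2" "0 < e"
  obtains n where "\<And>v w. \<lbrakk>v \<in> streams letters; w \<in> streams letters; stake n v = stake n w\<rbrakk>
    \<Longrightarrow> dist (proj \<beta>1 \<beta>2 v) (proj \<beta>1 \<beta>2 w) < e"
proof -
  define C where "C \<beta> = val \<beta> (sconst 1) - val \<beta> (sconst (-1))" for \<beta>
  have lim: "(\<lambda>n. C \<beta> / \<beta> ^ n) \<longlonglongrightarrow> 0" if "1 < \<beta>" for \<beta>
    using LIMSEQ_divide_realpow_zero[OF that] .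
  have "(\<lambda>n. C \<beta>1 / \<beta>1 ^ n + C \<beta>2 / \<beta>2 ^ n) \<longlonglongrightarrow> 0"
    using tendsto_add[OF lim[OF assms(1)] lim[OF assms(2)]] by simp
  then have "\<forall>\<^sub>F n in sequentially. C \<beta>1 / \<beta>1 ^ n + C \<beta>2 / \<beta>2 ^ n < e"
    using assms(3) by (rule order_tendstoD(2))
  then obtain n where n: "C \<beta>1 / \<beta>1 ^ n + C \<beta>2 / \<beta>2 ^ n < e"
    by (auto simp: eventually_sequentially)
  show thesis
  proof (rule that[of n])
    fix v w assume vw: "v \<in> streams letters" "w \<in> streams letters" "stake n v = stake n w"
    have "dist (proj \<beta>1 \<beta>2 v) (proj \<beta>1 \<beta>2 w)
        \<le> \<bar>val \<beta>1 v - val \<beta>1 w\<bar> + \<bar>val \<beta>2 v - val \<beta>2 w\<bar>"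
      unfolding proj_eq_val dist_Pair_Pair dist_real_def
      using sqrt_sum_squares_le_sum_abs[of "\<bar>val \<beta>1 v - val \<beta>1 w\<bar>" "\<bar>val \<beta>2 v - val \<beta>2 w\<bar>"]
      by simp
    also have "\<dots> \<le> C \<beta>1 / \<beta>1 ^ n + C \<beta>2 / \<beta>2 ^ n"
      unfolding C_def using vw assms(1,2) by (intro add_mono val_diff_le)
    finally show "dist (proj \<beta>1 \<beta>2 v) (proj \<beta>1 \<beta>2 w) < e" using n by simp
  qed
qed

text \<open>Tychonoff's theorem: identify words with points of the product of the finite sets \<open>F i\<close>, on
  which the two series converge uniformly.\<close>

lemma compact_proj_coordinatewise:
  assumes "1 < \<beta>1" "1 < \<beta>2" "\<And>i. F i \<subseteq> letters"
  shows "compact (proj \<beta>1 \<beta>2 ` {w. \<forall>i. w !! i \<in> F i})"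
proof -
  define K where "K = PiE UNIV F"
  define P where "P = (\<lambda>f::nat \<Rightarrow> real. (\<Sum>i. f i / \<beta>1 ^ Suc i, \<Sum>i. f i / \<beta>2 ^ Suc i))"
  have "compact (F i)" for i
    using assms(3)[of i] by (intro finite_imp_compact) (auto intro: finite_subset simp: letters_def)
  then have "compactin (product_topology (\<lambda>i. euclidean) UNIV) K"
    unfolding K_def compactin_PiE by simp
  then have K: "compact K" by (simp add: euclidean_product_topology)
  have cont: "continuous_on K (\<lambda>f. \<Sum>i. f i / \<beta> ^ Suc i)" if "1 < \<beta>" for \<beta> :: real
  proof (rule uniform_limit_theorem)
    show "\<forall>\<^sub>F n in sequentially. continuous_on K (\<lambda>f. \<Sum>i<n. f i / \<beta> ^ Suc i)"
      using that
      by (intro always_eventually allI continuous_intros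
          continuous_on_subset[OF continuous_on_product_coordinates]) auto
    show "uniform_limit K (\<lambda>n f. \<Sum>i<n. f i / \<beta> ^ Suc i) (\<lambda>f. \<Sum>i. f i / \<beta> ^ Suc i) sequentially"
    proof (rule Weierstrass_m_test[OF _ summable_inverse_powers[OF that]])
      fix n f assume "f \<in> K"
      then have "f n = 1 \<or> f n = -1"
        using assms(3)[of n] by (auto simp: K_def letters_def PiE_iff)
      then show "norm (f n / \<beta> ^ Suc n) \<le> 1 / \<beta> ^ Suc n"
        using that by auto
    qed
  qed simp
  have "continuous_on K P"
    unfolding P_def using assms(1,2) by (intro continuous_on_Pair cont)
  then have "compact (P ` K)" using K by (rule compact_continuous_image)
  moreover have "P ` K = proj \<beta>1 \<beta>2 ` {w. \<forall>i. w !! i \<in> F i}"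
  proof (intro subset_antisym subsetI)
    fix q assume "q \<in> P ` K"
    then obtain f where f: "f \<in> K" "q = P f" by blast
    have "q = proj \<beta>1 \<beta>2 (smap f nats)" "\<forall>i. smap f nats !! i \<in> F i"
      using f by (auto simp: P_def proj_def K_def PiE_iff)
    then show "q \<in> proj \<beta>1 \<beta>2 ` {w. \<forall>i. w !! i \<in> F i}" by blast
  next
    fix q assume "q \<in> proj \<beta>1 \<beta>2 ` {w. \<forall>i. w !! i \<in> F i}"
    then obtain w where w: "\<forall>i. w !! i \<in> F i" "q = proj \<beta>1 \<beta>2 w" by blast
    then have "(!!) w \<in> K" "q = P ((!!) w)"
      by (auto simp: P_def proj_def K_def)
    then show "q \<in> P ` K" by blast
  qed
  ultimately show ?thesis by simp
qed

lemma stake_eq_iff_snth: "stake n v = stake n w \<longleftrightarrow> (\<forall>i<n. v !! i = w !! i)"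
proof
  assume "stake n v = stake n w"
  then show "\<forall>i<n. v !! i = w !! i" by (metis stake_nth)
next
  assume "\<forall>i<n. v !! i = w !! i"
  then show "stake n v = stake n w" by (intro nth_equalityI) auto
qed

lemma snth_equalityI:
  assumes "\<And>i. v !! i = w !! i"
  shows "v = w"
  using assms by (metis stream_smap_nats ext)

lemma cylinder_singleton: "cylinder [c] = {w \<in> streams letters. shd w = c}"
  by (auto simp: cylinder_def)

lemma compact_proj_cylinder_m:
  assumes "1 < \<beta>1" "1 < \<beta>2"
  shows "compact (proj \<beta>1 \<beta>2 ` cylinder [-1])"
proof -
  have "cylinder [-1] = {w. \<forall>i. w !! i \<in> (if i = 0 then {-1} else letters)}"
  proof (intro subset_antisym subsetI)
    fix w assume "w \<in> cylinder [-1]"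
    then show "w \<in> {w. \<forall>i. w !! i \<in> (if i = 0 then {-1} else letters)}"
      by (simp add: cylinder_singleton streams_iff_snth)
  next
    fix w assume "w \<in> {w. \<forall>i. w !! i \<in> (if i = 0 then {-1} else letters)}"
    then have w: "w !! i \<in> (if i = 0 then {-1} else letters)" for i by blast
    have "w !! i \<in> letters" for i using w[of i] by (auto simp: letters_def split: if_splits)
    moreover have "shd w = -1" using w[of 0] by simp
    ultimately show "w \<in> cylinder [-1]" by (simp add: cylinder_singleton streams_iff_snth)
  qed
  moreover have "compact (proj \<beta>1 \<beta>2 ` {w. \<forall>i. w !! i \<in> (if i = 0 then {-1} else letters)})"
    using assms by (intro compact_proj_coordinatewise) (auto simp: letters_def)
  ultimately show ?thesis by simp
qed

text \<open>The words outside a cylinder are a finite union of coordinatewise sets, one for each position at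
  which the prefix may fail.\<close>

lemma compact_proj_outside_cylinder:
  assumes "1 < \<beta>1" "1 < \<beta>2"
  shows "compact (proj \<beta>1 \<beta>2 ` (streams letters - cylinder v))"
proof -
  define F where "F j = (\<lambda>i. if i = j then letters - {v ! j} else letters)" for j
  have "streams letters - cylinder v = (\<Union>j<length v. {w. \<forall>i. w !! i \<in> F j i})"
  proof (intro subset_antisym subsetI)
    fix w assume w: "w \<in> streams letters - cylinder v"
    then have "stake (length v) w \<noteq> v" by (simp add: cylinder_def)
    then obtain j where "j < length v" "w !! j \<noteq> v ! j"
      by (metis length_stake nth_equalityI stake_nth)
    then show "w \<in> (\<Union>j<length v. {w. \<forall>i. w !! i \<in> F j i})"
      using w by (auto simp: F_def streams_iff_snth)
  next
    fix w assume "w \<in> (\<Union>j<length v. {w. \<forall>i. w !! i \<in> F j i})"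
    then obtain j where j: "j < length v" "\<And>i. w !! i \<in> F j i" by blast
    have "w !! i \<in> letters" for i using j(2)[of i] by (auto simp: F_def split: if_splits)
    moreover have "w !! j \<noteq> v ! j" using j(2)[of j] by (simp add: F_def)
    then have "stake (length v) w \<noteq> v" using j(1) by (metis stake_nth)
    ultimately show "w \<in> streams letters - cylinder v"
      by (simp add: cylinder_def streams_iff_snth)
  qed
  then have "proj \<beta>1 \<beta>2 ` (streams letters - cylinder v)
      = (\<Union>j<length v. proj \<beta>1 \<beta>2 ` {w. \<forall>i. w !! i \<in> F j i})"
    by (simp add: image_UN)
  moreover have "compact (proj \<beta>1 \<beta>2 ` {w. \<forall>i. w !! i \<in> F j i})" for j
    using assms by (intro compact_proj_coordinatewise) (auto simp: F_def)
  ultimately show ?thesis by (auto intro: compact_UN)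
qed

section \<open>Eventually constant words of unique expansion\<close>

definition unique_word :: "real \<Rightarrow> real \<Rightarrow> real stream \<Rightarrow> bool" where
  "unique_word \<beta>1 \<beta>2 w \<longleftrightarrow>
     (\<forall>w' \<in> streams letters. proj \<beta>1 \<beta>2 w' = proj \<beta>1 \<beta>2 w \<longrightarrow> w' = w)"

lemma unique_word_if_in_uniqueness_set:
  assumes "proj \<beta>1 \<beta>2 w \<in> uniqueness_set \<beta>1 \<beta>2" "w \<in> streams letters"
  shows "unique_word \<beta>1 \<beta>2 w"
proof -
  obtain v where v: "proj \<beta>1 \<beta>2 v = proj \<beta>1 \<beta>2 w"
    "\<And>w'. w' \<in> streams letters \<Longrightarrow> w' \<noteq> v \<Longrightarrow> proj \<beta>1 \<beta>2 w' \<noteq> proj \<beta>1 \<beta>2 v"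
    using assms(1) unfolding uniqueness_set_def by auto
  have "w' = v" if "w' \<in> streams letters" "proj \<beta>1 \<beta>2 w' = proj \<beta>1 \<beta>2 w" for w'
    using v that by metis
  then show ?thesis unfolding unique_word_def using assms(2) by metis
qed

text \<open>Only words of the cylinder \<open>[v]\<close> have projections near that of \<open>v c\<^sup>\<infinity>\<close>, and none of these
  projections lies beyond it in the direction \<open>(c, 0)\<close>.\<close>

lemma unique_eventually_constant_in_frontier:
  assumes \<beta>: "1 < \<beta>1" "1 < \<beta>2" and v: "v \<in> lists letters" and c: "c \<in> letters"
    and uniq: "unique_word \<beta>1 \<beta>2 (v @- sconst c)"
  shows "proj \<beta>1 \<beta>2 (v @- sconst c) \<in> frontier (attractor \<beta>1 \<beta>2)"
proof -
  define s where "s = v @- sconst c"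
  define R where "R = proj \<beta>1 \<beta>2 ` (streams letters - cylinder v)"
  have s: "s \<in> streams letters"
    unfolding s_def using v c by (intro shift_streams sconst_streams)
  have scyl: "s \<in> cylinder v" using s by (simp add: cylinder_def s_def stake_shift)
  have "proj \<beta>1 \<beta>2 s \<notin> R"
    using uniq scyl unfolding R_def unique_word_def s_def by auto
  moreover have "closed R"
    unfolding R_def using compact_proj_outside_cylinder[OF \<beta>] by (rule compact_imp_closed)
  ultimately have openW: "open (interior (attractor \<beta>1 \<beta>2) - R)"
    by (intro open_Diff open_interior)
  have cc: "c * c = 1" using c by (auto simp: letters_def)
  have extremal: "c * val \<beta>1 u \<le> c * val \<beta>1 s" if "u \<in> cylinder v" for u
  proof -
    have u: "u \<in> streams letters" "\<And>i. i < length v \<Longrightarrow> u !! i = v ! i"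
      using that by (auto simp: cylinder_def) (metis stake_nth)
    have s_nth: "s !! i = (if i < length v then v ! i else c)" for i
      by (simp add: s_def shift_snth)
    from c consider "c = 1" | "c = -1" by (auto simp: letters_def)
    then show ?thesis
    proof cases
      case 1
      have "u !! i \<le> s !! i" for i
        using snth_letters[OF u(1), of i] u(2)[of i] s_nth[of i] 1 by (cases "i < length v") auto
      then have "val \<beta>1 u \<le> val \<beta>1 s" by (intro val_mono \<beta> u s)
      then show ?thesis using 1 by simp
    next
      case 2
      have "s !! i \<le> u !! i" for i
        using snth_letters[OF u(1), of i] u(2)[of i] s_nth[of i] 2 by (cases "i < length v") auto
      then have "val \<beta>1 s \<le> val \<beta>1 u" by (intro val_mono \<beta> u s)
      then show ?thesis using 2 by simp
    qed
  qed
  have "proj \<beta>1 \<beta>2 s \<notin> interior (attractor \<beta>1 \<beta>2)"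
  proof
    assume "proj \<beta>1 \<beta>2 s \<in> interior (attractor \<beta>1 \<beta>2)"
    then have "proj \<beta>1 \<beta>2 s \<in> interior (attractor \<beta>1 \<beta>2) - R"
      using \<open>proj \<beta>1 \<beta>2 s \<notin> R\<close> by simp
    then obtain r where r: "0 < r" "ball (proj \<beta>1 \<beta>2 s) r \<subseteq> interior (attractor \<beta>1 \<beta>2) - R"
      using openW open_contains_ball by blast
    define q where "q = (val \<beta>1 s + c * (r / 2), val \<beta>2 s)"
    have "dist (proj \<beta>1 \<beta>2 s) q < r"
      using r(1) c by (auto simp: q_def proj_eq_val dist_Pair_Pair dist_real_def letters_def)
    then have "q \<in> interior (attractor \<beta>1 \<beta>2) - R" using r(2) by (meson mem_ball subsetD)
    then have "q \<in> attractor \<beta>1 \<beta>2" "q \<notin> R" using interior_subset by blast+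
    then obtain u where "u \<in> cylinder v" "q = proj \<beta>1 \<beta>2 u"
      unfolding attractor_def R_def by blast
    then have "c * (val \<beta>1 s + c * (r / 2)) \<le> c * val \<beta>1 s"
      using extremal[of u] by (simp add: q_def proj_eq_val)
    then have "(c * c) * (r / 2) \<le> 0" by (simp add: algebra_simps)
    then show False using cc r(1) by simp
  qed
  moreover have "proj \<beta>1 \<beta>2 s \<in> closure (attractor \<beta>1 \<beta>2)"
    unfolding attractor_def using s by (intro subsetD[OF closure_subset] imageI)
  ultimately show ?thesis by (simp add: frontier_def s_def)
qed

section \<open>The constants \<open>L\<^sub>k\<close> and \<open>L\<close>\<close>

text \<open>The uniqueness half of Descartes' rule of signs for one change of sign. With \<open>t = b / a < 1\<close>, the
  factor \<open>t\<^bsup>i+1\<^esup>\<close> that turns the terms for \<open>b\<close> into those for \<open>a\<close> is larger than \<open>t\<^bsup>k+1\<^esup>\<close> on the nonnegative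
  terms and at most \<open>t\<^bsup>k+1\<^esup>\<close> on the nonpositive ones, so the sum for \<open>a\<close> exceeds \<open>t\<^bsup>k+1\<^esup>\<close> times the sum
  for \<open>b\<close>.\<close>

lemma one_sign_change_unique_zero:
  fixes a b :: real
  assumes ab: "0 < b" "b < a"
    and d: "0 < d 0" "0 < k" "\<And>i. i < k \<Longrightarrow> 0 \<le> d i" "\<And>i. k \<le> i \<Longrightarrow> d i \<le> 0"
    and suma: "summable (\<lambda>i. d i / a ^ Suc i)" and sumb: "summable (\<lambda>i. d i / b ^ Suc i)"
    and zero: "(\<Sum>i. d i / b ^ Suc i) = 0"
  shows "0 < (\<Sum>i. d i / a ^ Suc i)"
proof -
  define t where "t = b / a"
  \<comment> \<open>The exponent \<open>Suc k\<close> instead of \<open>k\<close> keeps the comparison strict at \<open>i = 0\<close> when \<open>k = 1\<close>.\<close>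
  have t: "0 < t" "t < 1" using ab by (auto simp: t_def)
  have conv: "d i / a ^ Suc i = t ^ Suc i * (d i / b ^ Suc i)" for i
    using ab unfolding t_def power_divide by (simp add: field_simps)
  have sumt: "summable (\<lambda>i. t ^ Suc k * (d i / b ^ Suc i))"
    using sumb by (rule summable_mult)
  have "0 < (\<Sum>i. d i / a ^ Suc i - t ^ Suc k * (d i / b ^ Suc i))"
  proof (rule suminf_pos2)
    show "summable (\<lambda>i. d i / a ^ Suc i - t ^ Suc k * (d i / b ^ Suc i))"
      using suma sumt by (rule summable_diff)
    show "0 \<le> d i / a ^ Suc i - t ^ Suc k * (d i / b ^ Suc i)" for i
    proof (cases "i < k")
      case True
      then have "t ^ Suc k \<le> t ^ Suc i" using t by (intro power_decreasing) auto
      moreover have "0 \<le> d i / b ^ Suc i" using d(3)[OF True] ab by simp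
      ultimately show ?thesis unfolding conv by (simp only: diff_ge_0_iff_ge mult_right_mono)
    next
      case False
      then have "t ^ Suc i \<le> t ^ Suc k" using t by (intro power_decreasing) auto
      moreover have "d i / b ^ Suc i \<le> 0" using d(4)[of i] False ab
        by (intro divide_nonpos_pos) auto
      ultimately show ?thesis unfolding conv by (simp only: diff_ge_0_iff_ge mult_right_mono_neg)
    qed
    have "t ^ Suc k < t ^ Suc 0" using t d(2) by (intro power_strict_decreasing) auto
    moreover have "0 < d 0 / b ^ Suc 0" using d(1) ab by simp
    ultimately show "0 < d 0 / a ^ Suc 0 - t ^ Suc k * (d 0 / b ^ Suc 0)"
      unfolding conv by (simp only: diff_gt_0_iff_gt mult_strict_right_mono)
  qed
  also have "\<dots> = (\<Sum>i. d i / a ^ Suc i) - t ^ Suc k * (\<Sum>i. d i / b ^ Suc i)"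
    using suminf_diff[OF suma sumt] suminf_mult[OF sumb, of "t ^ Suc k"] by simp
  finally show ?thesis using zero by simp
qed

text \<open>The letters of \<open>p\<^sup>k m\<^sup>\<infinity>\<close> minus those of a word in \<open>[m]\<close> are nonnegative before position \<open>k\<close>
  (and equal to \<open>2\<close> at the start) and nonpositive from there on, so that these differences, used as
  coefficients, cannot give a zero at both \<open>\<beta>1\<close> and \<open>\<beta>2\<close>.\<close>

lemma proj_p_block_m_tail_notin:
  assumes \<beta>: "1 < \<beta>1" "1 < \<beta>2" "\<beta>1 \<noteq> \<beta>2" and k: "1 \<le> k"
  shows "proj \<beta>1 \<beta>2 (replicate k 1 @- sconst (-1)) \<notin> proj \<beta>1 \<beta>2 ` cylinder [-1]"
proof
  define s :: "real stream" where "s = replicate k 1 @- sconst (-1)"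
  assume "proj \<beta>1 \<beta>2 (replicate k 1 @- sconst (-1)) \<in> proj \<beta>1 \<beta>2 ` cylinder [-1]"
  then obtain w where w: "w \<in> streams letters" "shd w = -1" and eq: "proj \<beta>1 \<beta>2 s = proj \<beta>1 \<beta>2 w"
    by (auto simp: cylinder_singleton s_def)
  have s_nth: "s !! i = (if i < k then 1 else -1)" for i
    by (simp add: s_def shift_snth)
  have s: "s \<in> streams letters" by (simp add: streams_iff_snth s_nth letters_def)
  define d where "d i = s !! i - w !! i" for i
  have sm: "summable (\<lambda>i. d i / \<beta> ^ Suc i)" if "1 < \<beta>" for \<beta>
    unfolding d_def diff_divide_distrib
    using that s w(1) by (intro summable_diff summable_val)
  have val: "(\<Sum>i. d i / \<beta> ^ Suc i) = val \<beta> s - val \<beta> w" if "1 < \<beta>" for \<beta>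
    unfolding d_def diff_divide_distrib val_def
    using that s w(1) by (intro suminf_diff[symmetric] summable_val)
  have zero: "(\<Sum>i. d i / \<beta>1 ^ Suc i) = 0" "(\<Sum>i. d i / \<beta>2 ^ Suc i) = 0"
    using eq \<beta> by (simp_all only: val) (simp_all add: proj_eq_val)
  have d0: "0 < d 0" using w(2) k s_nth[of 0] by (simp add: d_def)
  have dpos: "0 \<le> d i" if "i < k" for i
    using snth_letters[OF w(1), of i] that by (auto simp: d_def s_nth)
  have dneg: "d i \<le> 0" if "k \<le> i" for i
    using snth_letters[OF w(1), of i] that by (auto simp: d_def s_nth)
  have "0 < (\<Sum>i. d i / a ^ Suc i)"
    if "1 < b" "b < a" "(\<Sum>i. d i / b ^ Suc i) = 0" for a b :: real
    using that k d0 dpos dneg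
    by (intro one_sign_change_unique_zero[of b a d k] sm) auto
  from this[of \<beta>1 \<beta>2] this[of \<beta>2 \<beta>1] show False
    using \<beta> zero by (cases "\<beta>1 < \<beta>2") auto
qed

lemma proj_p_tail_notin:
  assumes "1 < \<beta>1"
  shows "proj \<beta>1 \<beta>2 (sconst 1) \<notin> proj \<beta>1 \<beta>2 ` cylinder [-1]"
proof
  assume "proj \<beta>1 \<beta>2 (sconst 1) \<in> proj \<beta>1 \<beta>2 ` cylinder [-1]"
  then obtain w where w: "w \<in> streams letters" "shd w = -1" "val \<beta>1 w = val \<beta>1 (sconst 1)"
    by (auto simp: cylinder_singleton proj_eq_val)
  have "w !! i \<le> sconst 1 !! i" for i using snth_letters[OF w(1), of i] by auto
  moreover have "w !! 0 < sconst 1 !! 0" using w(2) by simp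
  ultimately have "val \<beta>1 w < val \<beta>1 (sconst 1)"
    using assms w(1) by (intro val_strict_mono[of _ _ _ 0] sconst_streams) (auto simp: letters_def)
  then show False using w(3) by simp
qed

text \<open>The images of the cylinders around \<open>s\<close> shrink to a point outside the closed set \<open>\<pi>([m])\<close>.\<close>

lemma cylinder_separated_from_m:
  assumes \<beta>: "1 < \<beta>1" "1 < \<beta>2" and s: "s \<in> streams letters"
    and out: "proj \<beta>1 \<beta>2 s \<notin> proj \<beta>1 \<beta>2 ` cylinder [-1]"
  obtains n where "\<And>l. n \<le> l \<Longrightarrow>
    0 < setdist (proj \<beta>1 \<beta>2 ` cylinder (stake l s)) (proj \<beta>1 \<beta>2 ` cylinder [-1])"
proof -
  let ?K = "proj \<beta>1 \<beta>2 ` cylinder [-1]"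
  have "closed ?K" using compact_proj_cylinder_m[OF \<beta>] by (rule compact_imp_closed)
  then obtain e where e: "0 < e" "\<And>q. q \<in> ?K \<Longrightarrow> e \<le> dist (proj \<beta>1 \<beta>2 s) q"
    using separate_point_closed[OF _ out] by blast
  have "0 < e / 2" using e(1) by simp
  from proj_close_if_common_prefix[OF \<beta> this]
  obtain n where n: "\<And>v w. \<lbrakk>v \<in> streams letters; w \<in> streams letters; stake n v = stake n w\<rbrakk>
    \<Longrightarrow> dist (proj \<beta>1 \<beta>2 v) (proj \<beta>1 \<beta>2 w) < e / 2" by blast
  show thesis
  proof (rule that[of n])
    fix l assume l: "n \<le> l"
    have "e / 2 \<le> setdist (proj \<beta>1 \<beta>2 ` cylinder (stake l s)) ?K"
    proof (rule le_setdistI)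
      have "s \<in> cylinder (stake l s)" using s by (simp add: cylinder_def)
      then show "proj \<beta>1 \<beta>2 ` cylinder (stake l s) \<noteq> {}" by blast
      have "sconst (-1) \<in> cylinder [-1]"
        by (auto simp: cylinder_singleton letters_def intro!: sconst_streams)
      then show "?K \<noteq> {}" by blast
      fix x y assume x: "x \<in> proj \<beta>1 \<beta>2 ` cylinder (stake l s)" and y: "y \<in> ?K"
      from x obtain u where u: "u \<in> streams letters" "stake l u = stake l s" "x = proj \<beta>1 \<beta>2 u"
        by (auto simp: cylinder_def)
      have "stake n u = stake n s" using u(2) l unfolding stake_eq_iff_snth by auto
      then have "dist x (proj \<beta>1 \<beta>2 s) < e / 2" unfolding u(3) using n u(1) s by blast
      moreover have "e \<le> dist (proj \<beta>1 \<beta>2 s) y" using e(2) y .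
      ultimately show "e / 2 \<le> dist x y"
        using dist_triangle[of "proj \<beta>1 \<beta>2 s" y x] by (simp add: dist_commute)
    qed
    then show "0 < setdist (proj \<beta>1 \<beta>2 ` cylinder (stake l s)) ?K" using e(1) by simp
  qed
qed

text \<open>The small cylinders around \<open>p\<^sup>k m\<^sup>\<infinity>\<close> show that the minimum is over a nonempty set.\<close>

lemma Lmin_spec:
  assumes \<beta>: "1 < \<beta>1" "1 < \<beta>2" "\<beta>1 \<noteq> \<beta>2" and k: "1 \<le> k"
  shows "1 \<le> Lmin \<beta>1 \<beta>2 k"
    and "0 < setdist (proj \<beta>1 \<beta>2 ` cylinder (replicate k 1 @ replicate (Lmin \<beta>1 \<beta>2 k) (-1)))
                     (proj \<beta>1 \<beta>2 ` cylinder [-1])"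
proof -
  let ?P = "\<lambda>j. 1 \<le> j \<and>
     0 < setdist (proj \<beta>1 \<beta>2 ` cylinder (replicate k 1 @ replicate j (-1)))
                 (proj \<beta>1 \<beta>2 ` cylinder [-1])"
  let ?s = "replicate k 1 @- sconst (-1) :: real stream"
  have "?s \<in> streams letters"
    by (auto simp: letters_def intro!: shift_streams sconst_streams)
  from cylinder_separated_from_m[OF \<beta>(1,2) this proj_p_block_m_tail_notin[OF \<beta> k]]
  obtain n where n: "\<And>l. n \<le> l \<Longrightarrow>
    0 < setdist (proj \<beta>1 \<beta>2 ` cylinder (stake l ?s)) (proj \<beta>1 \<beta>2 ` cylinder [-1])" by blast
  have "stake (k + Suc n) ?s = replicate k 1 @ replicate (Suc n) (-1)"
    by (rule nth_equalityI) (auto simp: nth_append shift_snth simp del: replicate_Suc stake.simps)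
  then have "?P (Suc n)" using n[of "k + Suc n"] by simp
  then have "?P (Lmin \<beta>1 \<beta>2 k)" unfolding Lmin_def by (rule LeastI)
  then show "1 \<le> Lmin \<beta>1 \<beta>2 k"
    and "0 < setdist (proj \<beta>1 \<beta>2 ` cylinder (replicate k 1 @ replicate (Lmin \<beta>1 \<beta>2 k) (-1)))
                     (proj \<beta>1 \<beta>2 ` cylinder [-1])" by auto
qed

lemma Lmin_eventually_1:
  assumes \<beta>: "1 < \<beta>1" "1 < \<beta>2"
  obtains N where "\<And>k. N \<le> k \<Longrightarrow> Lmin \<beta>1 \<beta>2 k = 1"
proof -
  have "sconst 1 \<in> streams letters" by (auto simp: letters_def intro!: sconst_streams)
  from cylinder_separated_from_m[OF \<beta> this proj_p_tail_notin[OF \<beta>(1)]]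
  obtain n where n: "\<And>l. n \<le> l \<Longrightarrow> 0 < setdist (proj \<beta>1 \<beta>2 ` cylinder (stake l (sconst 1)))
    (proj \<beta>1 \<beta>2 ` cylinder [-1])" by blast
  show thesis
  proof (rule that[of n])
    fix k assume "n \<le> k"
    then have pos: "0 < setdist (proj \<beta>1 \<beta>2 ` cylinder (stake k (sconst 1)))
      (proj \<beta>1 \<beta>2 ` cylinder [-1])" by (rule n)
    have "stake k (sconst 1) = replicate k (1::real)" by (rule nth_equalityI) auto
    then have sub: "cylinder (replicate k 1 @ [-1]) \<subseteq> cylinder (stake k (sconst 1))"
    proof -
      have "stake k u = stake k (sconst 1)" if u: "stake (Suc k) u = replicate k 1 @ [-1]" for u
        unfolding stake_eq_iff_snth
      proof (intro allI impI)
        fix i assume "i < k"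
        then have "u !! i = (replicate k 1 @ [-1]) ! i" by (simp flip: u del: stake.simps)
        then show "u !! i = sconst 1 !! i" using \<open>i < k\<close> by (simp add: nth_append)
      qed
      then show ?thesis by (auto simp: cylinder_def simp del: stake.simps)
    qed
    have "replicate k 1 @ [-1] \<in> lists letters" "1 \<in> letters" by (auto simp: letters_def)
    then have "(replicate k 1 @ [-1]) @- sconst 1 \<in> streams letters"
      by (intro shift_streams sconst_streams)
    then have "(replicate k 1 @ [-1]) @- sconst 1 \<in> cylinder (replicate k 1 @ [-1 :: real])"
      unfolding cylinder_def mem_Collect_eq stake_shift by simp
    then have "setdist (proj \<beta>1 \<beta>2 ` cylinder (stake k (sconst 1))) (proj \<beta>1 \<beta>2 ` cylinder [-1])
      \<le> setdist (proj \<beta>1 \<beta>2 ` cylinder (replicate k 1 @ [-1])) (proj \<beta>1 \<beta>2 ` cylinder [-1])"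
      using sub by (intro setdist_subset_left) auto
    then have "0 < setdist (proj \<beta>1 \<beta>2 ` cylinder (replicate k 1 @ [-1]))
      (proj \<beta>1 \<beta>2 ` cylinder [-1])" using pos by linarith
    then show "Lmin \<beta>1 \<beta>2 k = 1" unfolding Lmin_def by (intro Least_equality) auto
  qed
qed

lemma Lmin_le_Lmax:
  assumes "1 < \<beta>1" "1 < \<beta>2" "1 \<le> k"
  shows "Lmin \<beta>1 \<beta>2 k \<le> Lmax \<beta>1 \<beta>2"
proof -
  obtain N where "\<And>k. N \<le> k \<Longrightarrow> Lmin \<beta>1 \<beta>2 k = 1"
    using Lmin_eventually_1[OF assms(1,2)] by blast
  then have "Lmin \<beta>1 \<beta>2 ` {1..} \<subseteq> insert 1 (Lmin \<beta>1 \<beta>2 ` {..<N})"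
    by (auto simp: image_iff) (metis lessThan_iff not_le)
  then have "finite (Lmin \<beta>1 \<beta>2 ` {1..})" by (rule finite_subset) simp
  then show ?thesis unfolding Lmax_def using assms(3) by (intro Max_ge) auto
qed

section \<open>Spaced words\<close>

text \<open>After each switch of letters, the new letter is kept for at least \<open>L\<close> positions. This property of
  positions is inherited by suffixes, letterwise images and eventually constant truncations, without
  any decomposition into blocks.\<close>

definition spaced :: "nat \<Rightarrow> 'a stream \<Rightarrow> bool" where
  "spaced L w \<longleftrightarrow> (\<forall>i j. w !! i \<noteq> w !! Suc i \<longrightarrow> i < j \<longrightarrow> j \<le> i + L \<longrightarrow> w !! j = w !! Suc i)"

lemma spaced_sdrop:
  assumes "spaced L w"
  shows "spaced L (sdrop n w)"
  unfolding spaced_def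
proof (intro allI impI)
  fix i j assume "sdrop n w !! i \<noteq> sdrop n w !! Suc i" "i < j" "j \<le> i + L"
  then show "sdrop n w !! j = sdrop n w !! Suc i"
    using assms[unfolded spaced_def, rule_format, of "n + i" "n + j"] by (simp add: sdrop_snth)
qed

lemma spaced_smap: "spaced L w \<Longrightarrow> spaced L (smap f w)"
  unfolding spaced_def by (metis snth_smap)

text \<open>The word with letters \<open>w\<^bsub>min(i,n)\<^esub>\<close>: a switch of letters can only occur at or before position
  \<open>n\<close>, and the run that it starts can only become longer.\<close>

lemma spaced_freeze:
  assumes "spaced L w"
  shows "spaced L (stake n w @- sconst (w !! n))"
proof -
  have nth: "(stake n w @- sconst (w !! n)) !! i = w !! min i n" for i
    by (simp add: shift_snth min_def)
  show ?thesis
    unfolding spaced_def nth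
  proof (intro allI impI)
    fix i j assume *: "w !! min i n \<noteq> w !! min (Suc i) n" "i < j" "j \<le> i + L"
    have "Suc i \<le> n"
    proof (rule ccontr)
      assume "\<not> Suc i \<le> n"
      then have "min i n = n" "min (Suc i) n = n" by auto
      then show False using *(1) by simp
    qed
    then show "w !! min j n = w !! min (Suc i) n"
      using assms[unfolded spaced_def, rule_format, of i "min j n"] * by (auto simp: min_def)
  qed
qed

text \<open>The induction is on the position of the switch and drops the first block at each step; it therefore
  concerns all the words \<open>B n\<close> at once.\<close>

lemma spaced_flat_replicate:
  fixes k :: "nat \<Rightarrow> nat" and c :: "nat \<Rightarrow> 'a"
  defines "B \<equiv> \<lambda>n. flat (smap (\<lambda>i. replicate (k i) (c i)) (fromN n))"
  assumes pos: "\<And>i. 1 \<le> k i" and long: "\<And>i. 1 \<le> i \<Longrightarrow> L \<le> k i"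
  shows "spaced L (B 0)"
proof -
  have B: "B n = replicate (k n) (c n) @- B (Suc n)" for n
    unfolding B_def using pos[of n] by (subst flat_unfold) auto
  have nth1: "B n !! i = c n" if "i < k n" for n i
    using that by (subst B) (simp add: shift_snth)
  have nth2: "B n !! i = B (Suc n) !! (i - k n)" if "k n \<le> i" for n i
    using that by (subst B) (simp add: shift_snth)
  have "B n !! j = B n !! Suc i" if "B n !! i \<noteq> B n !! Suc i" "i < j" "j \<le> i + L" for i j n
    using that
  proof (induction i arbitrary: n j rule: less_induct)
    case (less i)
    consider "Suc i < k n" | "Suc i = k n" | "k n \<le> i" by linarith
    then show ?case
    proof cases
      case 1
      then show ?thesis using less.prems(1) nth1[of i n] nth1[of "Suc i" n] by simp
    next
      case 2
      then have "j - k n < k (Suc n)"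
        using less.prems(2,3) long[of "Suc n"] pos[of "Suc n"] by linarith
      then show ?thesis
        using 2 less.prems(2) pos[of "Suc n"] nth2[of n j] nth2[of n "Suc i"]
          nth1[of "j - k n" "Suc n"] nth1[of 0 "Suc n"] by simp
    next
      case 3
      have shift: "B n !! i = B (Suc n) !! (i - k n)"
        "B n !! Suc i = B (Suc n) !! Suc (i - k n)" "B n !! j = B (Suc n) !! (j - k n)"
        using 3 less.prems(2) nth2[of n i] nth2[of n "Suc i"] nth2[of n j] Suc_diff_le[OF 3]
        by auto
      show ?thesis
        unfolding shift
      proof (rule less.IH)
        show "i - k n < i" using 3 pos[of n] by linarith
        show "B (Suc n) !! (i - k n) \<noteq> B (Suc n) !! Suc (i - k n)"
          using less.prems(1) unfolding shift .
        show "i - k n < j - k n" "j - k n \<le> i - k n + L" using less.prems(2,3) 3 by linarith+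
      qed
    qed
  qed
  then show ?thesis unfolding spaced_def by blast
qed

lemma blocks_spaced:
  assumes a: "a \<in> letters" and k0: "1 \<le> k 0" and k: "\<And>i. 1 \<le> i \<Longrightarrow> L \<le> k i" and L: "1 \<le> L"
  shows "blocks a k \<in> streams letters" "spaced L (blocks a k)"
proof -
  have pos: "1 \<le> k i" for i using k0 k[of i] L by (cases i) auto
  show "spaced L (blocks a k)"
    unfolding blocks_def using pos k by (intro spaced_flat_replicate) auto
  have ne: "\<forall>xs \<in> sset (smap (\<lambda>i. replicate (k i) (if even i then a else - a)) nats). xs \<noteq> []"
    using pos by (auto simp: stream.set_map Suc_le_eq)
  show "blocks a k \<in> streams letters"
    unfolding blocks_def streams_iff_sset sset_flat[OF ne]
    using a by (auto simp: stream.set_map letters_def split: if_splits)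
qed

lemma U'_spaced:
  assumes \<beta>: "1 < \<beta>1" "1 < \<beta>2" "\<beta>1 \<noteq> \<beta>2" and w: "w \<in> U' \<beta>1 \<beta>2"
  shows "w \<in> streams letters" "spaced (Lmax \<beta>1 \<beta>2) w"
proof -
  have L: "1 \<le> Lmax \<beta>1 \<beta>2"
    using Lmin_spec(1)[OF \<beta>, of 1] Lmin_le_Lmax[OF \<beta>(1,2), of 1] by simp
  from w obtain a k where "w = blocks a k" "a \<in> letters" "1 \<le> k 0" "\<And>i. 1 \<le> i \<Longrightarrow> Lmax \<beta>1 \<beta>2 \<le> k i"
    unfolding U'_def letters_def by blast
  then show "w \<in> streams letters" "spaced (Lmax \<beta>1 \<beta>2) w"
    using blocks_spaced[OF _ _ _ L] by auto
qed

text \<open>Either \<open>v\<close> is \<open>p\<^sup>\<infinity>\<close>, which is extremal, or its first block \<open>p\<^sup>k\<close> is followed by at least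
  \<open>L \<ge> L\<^sub>k\<close> letters \<open>m\<close>.\<close>

lemma spaced_p_m_proj_neq:
  assumes \<beta>: "1 < \<beta>1" "1 < \<beta>2" "\<beta>1 \<noteq> \<beta>2"
    and v: "v \<in> streams letters" "spaced (Lmax \<beta>1 \<beta>2) v" "shd v = 1"
    and w: "w \<in> streams letters" "shd w = -1"
  shows "proj \<beta>1 \<beta>2 v \<noteq> proj \<beta>1 \<beta>2 w"
proof (cases "\<forall>i. v !! i = 1")
  case True
  then have "v = sconst 1" by (intro snth_equalityI) simp
  then show ?thesis
    using proj_p_tail_notin[OF \<beta>(1), of \<beta>2] w by (auto simp: cylinder_singleton)
next
  case False
  define k where "k = (LEAST i. v !! i \<noteq> 1)"
  have vk: "v !! k \<noteq> 1" using False unfolding k_def by (metis (mono_tags, lifting) LeastI)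
  have before: "v !! i = 1" if "i < k" for i
    using that not_less_Least unfolding k_def by blast
  have k: "1 \<le> k" using vk v(3) by (cases k) auto
  have vk_m: "v !! k = -1" using vk snth_letters[OF v(1), of k] by auto
  define j where "j = Lmin \<beta>1 \<beta>2 k"
  have j: "j \<le> Lmax \<beta>1 \<beta>2" unfolding j_def by (rule Lmin_le_Lmax[OF \<beta>(1,2) k])
  have after: "v !! i = -1" if "k \<le> i" "i < k + j" for i
    using v(2)[unfolded spaced_def, rule_format, of "k - 1" i] k vk_m before[of "k - 1"] that j
    by auto
  have "stake (k + j) v = replicate k 1 @ replicate j (-1)"
    by (rule nth_equalityI) (auto simp: nth_append before after)
  then have "v \<in> cylinder (replicate k 1 @ replicate j (-1))"
    using v(1) by (simp add: cylinder_def)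
  moreover have "w \<in> cylinder [-1]" using w by (simp add: cylinder_singleton)
  ultimately have "setdist (proj \<beta>1 \<beta>2 ` cylinder (replicate k 1 @ replicate j (-1)))
      (proj \<beta>1 \<beta>2 ` cylinder [-1]) \<le> dist (proj \<beta>1 \<beta>2 v) (proj \<beta>1 \<beta>2 w)"
    by (intro setdist_le_dist imageI)
  moreover have "0 < setdist (proj \<beta>1 \<beta>2 ` cylinder (replicate k 1 @ replicate j (-1)))
      (proj \<beta>1 \<beta>2 ` cylinder [-1])"
    unfolding j_def by (rule Lmin_spec(2)[OF \<beta> k])
  ultimately show ?thesis by auto
qed

text \<open>Two words with the same projection still have the same projection after their common prefix is
  dropped, and the remaining words start with different letters.\<close>

lemma spaced_unique:
  assumes \<beta>: "1 < \<beta>1" "1 < \<beta>2" "\<beta>1 \<noteq> \<beta>2"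
    and w: "w \<in> streams letters" "spaced (Lmax \<beta>1 \<beta>2) w"
  shows "unique_word \<beta>1 \<beta>2 w"
  unfolding unique_word_def
proof (intro ballI impI, rule ccontr)
  fix w' assume w': "w' \<in> streams letters" "proj \<beta>1 \<beta>2 w' = proj \<beta>1 \<beta>2 w" "w' \<noteq> w"
  define n where "n = (LEAST i. w' !! i \<noteq> w !! i)"
  have "\<exists>i. w' !! i \<noteq> w !! i" using w'(3) snth_equalityI by blast
  then have neq: "w' !! n \<noteq> w !! n" unfolding n_def by (rule LeastI_ex)
  have "\<forall>i<n. w' !! i = w !! i" using not_less_Least unfolding n_def by blast
  then have prefix: "stake n w' = stake n w" by (simp add: stake_eq_iff_snth)
  define v v' where "v = sdrop n w" and "v' = sdrop n w'"
  have v: "v \<in> streams letters" "spaced (Lmax \<beta>1 \<beta>2) v" "v' \<in> streams letters"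
    unfolding v_def v'_def using w w' by (auto intro: sdrop_streams spaced_sdrop)
  have val_eq: "val \<beta> v' = val \<beta> v" if "1 < \<beta>" "val \<beta> w' = val \<beta> w" for \<beta>
    using val_diff_common_prefix[OF that(1) w'(1) w(1) prefix] that by (simp add: v_def v'_def)
  then have eq: "val \<beta>1 v' = val \<beta>1 v" "val \<beta>2 v' = val \<beta>2 v"
    using \<beta> w'(2) by (simp_all add: proj_eq_val)
  have "shd v' \<noteq> shd v" using neq by (simp add: v_def v'_def)
  moreover have "shd v = 1 \<or> shd v = -1" "shd v' = 1 \<or> shd v' = -1"
    using snth_letters[OF v(1), of 0] snth_letters[OF v(3), of 0] by auto
  ultimately consider "shd v = 1" "shd v' = -1" | "shd v = -1" "shd v' = 1" by auto
  then show False
  proof cases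
    case 1
    then show False using spaced_p_m_proj_neq[OF \<beta> v(1,2) _ v(3)] eq by (simp add: proj_eq_val)
  next
    case 2
    \<comment> \<open>Exchanging \<open>p\<close> and \<open>m\<close> negates both projections.\<close>
    have "smap uminus u \<in> streams letters" if "u \<in> streams letters" for u
      using that by (auto simp: streams_iff_snth letters_def)
    then have "proj \<beta>1 \<beta>2 (smap uminus v) \<noteq> proj \<beta>1 \<beta>2 (smap uminus v')"
      using 2 v by (intro spaced_p_m_proj_neq[OF \<beta>] spaced_smap) auto
    then show False using eq v \<beta> by (simp add: proj_eq_val val_uminus)
  qed
qed

text \<open>The truncations \<open>u\<close> are spaced and eventually constant, so their projections are frontier points,
  and they converge to the projection of \<open>w\<close>.\<close>

lemma spaced_in_frontier:
  assumes \<beta>: "1 < \<beta>1" "1 < \<beta>2" "\<beta>1 \<noteq> \<beta>2"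
    and w: "w \<in> streams letters" "spaced (Lmax \<beta>1 \<beta>2) w"
  shows "proj \<beta>1 \<beta>2 w \<in> frontier (attractor \<beta>1 \<beta>2)"
proof -
  have "\<exists>q \<in> frontier (attractor \<beta>1 \<beta>2). dist q (proj \<beta>1 \<beta>2 w) < e" if e: "0 < e" for e
  proof -
    obtain n where n: "\<And>u v. \<lbrakk>u \<in> streams letters; v \<in> streams letters; stake n u = stake n v\<rbrakk>
      \<Longrightarrow> dist (proj \<beta>1 \<beta>2 u) (proj \<beta>1 \<beta>2 v) < e"
      using proj_close_if_common_prefix[OF \<beta>(1,2) e] by blast
    define u where "u = stake n w @- sconst (w !! n)"
    have letters: "stake n w \<in> lists letters" "w !! n \<in> letters"
      using w(1) by (auto simp: streams_iff_snth in_set_conv_nth)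
    then have u: "u \<in> streams letters"
      unfolding u_def by (intro shift_streams sconst_streams)
    have "unique_word \<beta>1 \<beta>2 u"
      using \<beta> u w(2) unfolding u_def by (intro spaced_unique spaced_freeze)
    then have "proj \<beta>1 \<beta>2 u \<in> frontier (attractor \<beta>1 \<beta>2)"
      unfolding u_def using letters \<beta> by (intro unique_eventually_constant_in_frontier)
    moreover have "stake n u = stake n w" by (simp add: u_def stake_shift)
    then have "dist (proj \<beta>1 \<beta>2 u) (proj \<beta>1 \<beta>2 w) < e" using n u w(1) by blast
    ultimately show ?thesis by blast
  qed
  then have "proj \<beta>1 \<beta>2 w \<in> closure (frontier (attractor \<beta>1 \<beta>2))"
    unfolding closure_approachable by blast
  then show ?thesis using frontier_closed by (simp add: closure_closed)
qed

theorem proposition4p6: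
  fixes \<beta>1 \<beta>2 :: real
  assumes "1 < \<beta>1" and "1 < \<beta>2" and "\<beta>1 \<noteq> \<beta>2"
  shows "(\<forall>w \<in> lists letters. \<forall>x y.
            ((x, y) = proj \<beta>1 \<beta>2 (w @- sconst (-1)) \<or> (x, y) = proj \<beta>1 \<beta>2 (w @- sconst 1)) \<and>
            (x, y) \<in> uniqueness_set \<beta>1 \<beta>2 \<longrightarrow> (x, y) \<in> frontier (attractor \<beta>1 \<beta>2)) \<and>
         proj \<beta>1 \<beta>2 ` U' \<beta>1 \<beta>2 \<subseteq> frontier (attractor \<beta>1 \<beta>2)"
proof (intro conjI ballI allI impI)
  fix w x y
  assume w: "w \<in> lists letters"
    and "((x, y) = proj \<beta>1 \<beta>2 (w @- sconst (-1)) \<or> (x, y) = proj \<beta>1 \<beta>2 (w @- sconst 1)) \<and>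
      (x, y) \<in> uniqueness_set \<beta>1 \<beta>2"
  then obtain c where c: "c \<in> letters" "(x, y) = proj \<beta>1 \<beta>2 (w @- sconst c)"
    "(x, y) \<in> uniqueness_set \<beta>1 \<beta>2"
    unfolding letters_def by blast
  have "w @- sconst c \<in> streams letters" using w c(1) by (intro shift_streams sconst_streams)
  then have "unique_word \<beta>1 \<beta>2 (w @- sconst c)"
    using c by (intro unique_word_if_in_uniqueness_set) auto
  then show "(x, y) \<in> frontier (attractor \<beta>1 \<beta>2)"
    unfolding c(2) using w c(1) assms by (intro unique_eventually_constant_in_frontier)
next
  show "proj \<beta>1 \<beta>2 ` U' \<beta>1 \<beta>2 \<subseteq> frontier (attractor \<beta>1 \<beta>2)"
    using U'_spaced[OF assms] spaced_in_frontier[OF assms] by blast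
qed

end
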